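(* Let $X$ be a linearly ordered topological pospace and let $L$ be a subspace of $X$ such that $L$ (with the induced order) is an $H$-closed topological pospace and every maximal $X\setminus L$-chain in $X$ is an $H$-closed topological pospace. Then $X$ is an $H$-closed topological pospace.
   Context: All topological spaces are Hausdorff. A topological pospace is a topological space $X$ equipped with a continuous (closed) partial order $\leqslant$, i.e. one whose graph is closed in $X\times X$; it is linearly ordered if $\leqslant$ is a linear order. A topological pospace $X$ is $H$-closed if $X$ is a closed subspace of every Hausdorff topological pospace in which it is contained (as a subspace with the induced order). For $x\in X$, ${\uparrow}x=\{y\in X\mid x\leqslant y\}$ and ${\downarrow}x=\{y\in X\mid y\leqslant x\}$. For a subset $A$ of a linearly ordered set $X$, a subset $S\subseteq A$ is called an $A$-chain in $X$ if ${\uparrow}x\cap{\downarrow}y\subseteq A$ for all $x,y\in S$ with $x\leqslant y$; a maximal $A$-chain is an $A$-chain properly contained in no other $A$-chain. Subsets of $X$ are regarded as pospaces with the subspace topology and the induced order. *)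

theory Defs
  imports "HOL-Analysis.Analysis"
begin

definition pospace :: "'a topology \<Rightarrow> 'a rel \<Rightarrow> bool" where
  "pospace X r \<longleftrightarrow>
     Hausdorff_space X \<and> partial_order_on (topspace X) r \<and> closedin (prod_topology X X) r"

definition linear_pospace :: "'a topology \<Rightarrow> 'a rel \<Rightarrow> bool" where
  "linear_pospace X r \<longleftrightarrow> pospace X r \<and> linear_order_on (topspace X) r"

definition pospace_embedding ::
    "'a topology \<Rightarrow> 'a rel \<Rightarrow> 'b topology \<Rightarrow> 'b rel \<Rightarrow> ('a \<Rightarrow> 'b) \<Rightarrow> bool" where
  "pospace_embedding X r Y s f \<longleftrightarrow>
     embedding_map X Y f \<and>
     (\<forall>x\<in>topspace X. \<forall>y\<in>topspace X. (x, y) \<in> r \<longleftrightarrow> (f x, f y) \<in> s)"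

text \<open>
  The definition of an H-closed pospace quantifies over all pospaces containing \<open>X\<close>. A HOL
  definition cannot quantify over types, so the containing pospaces are taken on the type
  \<open>'a option\<close>. This is no restriction: if \<open>X\<close> is not closed in \<open>Y\<close>, it is not closed in the
  subspace of \<open>Y\<close> obtained by adding a single point of its closure. The lemma
  \<open>H_closed_pospace_closedin\<close> below derives the unrestricted property, for \<open>Y\<close> on any type.
\<close>

definition H_closed_pospace :: "'a topology \<Rightarrow> 'a rel \<Rightarrow> bool" where
  "H_closed_pospace X r \<longleftrightarrow>
     pospace X r \<and>
     (\<forall>(Y :: 'a option topology) s f.
        pospace Y s \<and> pospace_embedding X r Y s f \<longrightarrow> closedin Y (f ` topspace X))"

definition chain_in :: "'a rel \<Rightarrow> 'a set \<Rightarrow> 'a set \<Rightarrow> bool" where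
  "chain_in r A S \<longleftrightarrow>
     S \<subseteq> A \<and> (\<forall>x\<in>S. \<forall>y\<in>S. (x, y) \<in> r \<longrightarrow> above r x \<inter> under r y \<subseteq> A)"

definition maximal_chain_in :: "'a rel \<Rightarrow> 'a set \<Rightarrow> 'a set \<Rightarrow> bool" where
  "maximal_chain_in r A S \<longleftrightarrow> chain_in r A S \<and> \<not> (\<exists>T. chain_in r A T \<and> S \<subset> T)"

lemma pospace_pullback:
  fixes Y :: "'b topology" and h :: "'c \<Rightarrow> 'b"
  assumes Y: "pospace Y s" and inj: "inj_on h S" and hS: "h ` S \<subseteq> topspace Y"
  shows "pospace (pullback_topology S h Y) {(u, v) \<in> S \<times> S. (h u, h v) \<in> s}"
    (is "pospace ?Z ?t")
proof -
  have top: "topspace ?Z = S"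
    using hS by (auto simp: topspace_pullback_topology)
  have cont: "continuous_map ?Z Y h"
    using continuous_map_pullback[OF continuous_map_id, of S h Y] by (simp add: id_def comp_def)
  have "Hausdorff_space ?Z"
    using Hausdorff_space_injective_preimage[OF _ cont] Y inj top by (simp add: pospace_def)
  moreover have "partial_order_on (topspace ?Z) ?t"
  proof -
    have po: "refl_on (topspace Y) s" "trans s" "antisym s"
      using Y by (auto simp: pospace_def order_on_defs)
    have "refl_on S ?t"
      using po(1) hS by (auto simp: refl_on_def)
    moreover have "trans ?t"
      using po(2) by (auto simp: trans_def)
    moreover have "antisym ?t"
      using po(3) inj by (auto simp: antisym_def inj_on_def)
    ultimately show ?thesis
      unfolding top order_on_defs by auto
  qed
  moreover have "closedin (prod_topology ?Z ?Z) ?t"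
  proof -
    have "continuous_map (prod_topology ?Z ?Z) (prod_topology Y Y) (\<lambda>p. (h (fst p), h (snd p)))"
      using continuous_map_compose[OF continuous_map_fst cont]
        continuous_map_compose[OF continuous_map_snd cont]
      by (intro continuous_map_pairedI) (simp_all add: comp_def)
    then have "closedin (prod_topology ?Z ?Z)
        {p \<in> topspace (prod_topology ?Z ?Z). (h (fst p), h (snd p)) \<in> s}"
      using Y by (intro closedin_continuous_map_preimage) (auto simp: pospace_def)
    also have "{p \<in> topspace (prod_topology ?Z ?Z). (h (fst p), h (snd p)) \<in> s} = ?t"
      using top by auto
    finally show ?thesis .
  qed
  ultimately show ?thesis
    by (simp add: pospace_def)
qed

lemma H_closed_pospace_closedin:
  fixes X :: "'a topology" and Y :: "'b topology"
  assumes H: "H_closed_pospace X r" and Y: "pospace Y s" and f: "pospace_embedding X r Y s f"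
  shows "closedin Y (f ` topspace X)"
proof (rule ccontr)
  assume notcl: "\<not> closedin Y (f ` topspace X)"
  have emb: "embedding_map X Y f"
    using f by (simp add: pospace_embedding_def)
  then have hom: "homeomorphic_map X (subtopology Y (f ` topspace X)) f"
    by (simp add: embedding_map_def)
  have finj: "inj_on f (topspace X)"
    using hom by (simp add: homeomorphic_eq_everything_map)
  have contf: "continuous_map X Y f"
    using homeomorphic_imp_continuous_map[OF hom] by (simp add: continuous_map_in_subtopology)
  have fsub: "f ` topspace X \<subseteq> topspace Y"
    using contf by (rule continuous_map_image_subset_topspace)
  obtain y where y: "y \<in> Y closure_of (f ` topspace X)" "y \<notin> f ` topspace X"
    using notcl fsub closure_of_subset_eq[of "f ` topspace X" Y] by blast
  have yY: "y \<in> topspace Y"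
    using y(1) by (simp add: in_closure_of)
  define h where "h u = (case u of None \<Rightarrow> y | Some x \<Rightarrow> f x)" for u
  define S where "S = insert None (Some ` topspace X)"
  define Z where "Z = pullback_topology S h Y"
  define t where "t = {(u, v) \<in> S \<times> S. (h u, h v) \<in> s}"
  have hinj: "inj_on h S"
    using finj y(2) by (auto simp: inj_on_def h_def S_def)
  have hS: "h ` S \<subseteq> topspace Y"
    using fsub yY by (auto simp: h_def S_def)
  have Z: "pospace Z t"
    unfolding Z_def t_def by (rule pospace_pullback[OF Y hinj hS])
  have top: "topspace Z = S"
    using hS by (auto simp: Z_def topspace_pullback_topology)
  have conth: "continuous_map Z Y h"
    using continuous_map_pullback[OF continuous_map_id, of S h Y] by (simp add: id_def comp_def Z_def)
  have contSome: "continuous_map X Z Some"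
    unfolding Z_def
    by (rule continuous_map_pullback') (use contf in \<open>auto simp: S_def comp_def h_def\<close>)
  have "embedding_map X Z Some"
  proof -
    let ?W = "subtopology Z (Some ` topspace X)"
    obtain g where g: "homeomorphic_maps X (subtopology Y (f ` topspace X)) f g"
      using hom homeomorphic_map_maps by blast
    have gf: "g (f x) = x" if "x \<in> topspace X" for x
      using g that by (simp add: homeomorphic_maps_def)
    have Wtop: "topspace ?W = Some ` topspace X"
      by (auto simp: top S_def)
    have "continuous_map ?W (subtopology Y (f ` topspace X)) h"
      unfolding continuous_map_in_subtopology Wtop
      using continuous_map_from_subtopology[OF conth] by (auto simp: h_def)
    then have "continuous_map ?W X (g \<circ> h)"
      by (rule continuous_map_compose) (use g in \<open>simp add: homeomorphic_maps_def\<close>)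
    moreover have "continuous_map X ?W Some"
      using contSome by (simp add: continuous_map_in_subtopology)
    ultimately have "homeomorphic_maps X ?W Some (g \<circ> h)"
      unfolding homeomorphic_maps_def Wtop by (auto simp: h_def gf)
    then show ?thesis
      unfolding embedding_map_def homeomorphic_map_maps by blast
  qed
  then have "pospace_embedding X r Z t Some"
    using f by (simp add: pospace_embedding_def t_def S_def h_def)
  then have "closedin Z (Some ` topspace X)"
    using H Z unfolding H_closed_pospace_def by blast
  then have "openin Z (topspace Z - Some ` topspace X)"
    by (simp add: openin_diff)
  moreover have "topspace Z - Some ` topspace X = {None}"
    by (auto simp: top S_def)
  ultimately obtain V where V: "openin Y V" "{None} = h -` V \<inter> S"
    by (auto simp: Z_def openin_pullback_topology)
  have "None \<in> h -` V"
    using V(2) by blast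
  then have "y \<in> V"
    by (simp add: h_def)
  then obtain z where "z \<in> f ` topspace X" "z \<in> V"
    using y(1) V(1) unfolding in_closure_of by blast
  then obtain x where "x \<in> topspace X" "f x \<in> V"
    by auto
  then have "Some x \<in> h -` V \<inter> S"
    by (simp add: h_def S_def)
  then have "Some x \<in> {None}"
    by (simp only: V(2))
  then show False
    by simp
qed

end

theory Submission
  imports Defs
begin

text \<open>
  Let \<open>X\<close> be contained in a pospace \<open>Y\<close>, and suppose that \<open>y\<close> lies in the closure of \<open>X\<close> but not
  in \<open>X\<close>. The order of \<open>Y\<close> need not be linear, but since it is closed, each point of \<open>X\<close> is
  comparable to \<open>y\<close>: this property passes from the chain \<open>X\<close> to its closure
  (\<open>comparable_with_closure_of_chain\<close>). Hence \<open>y\<close> cuts \<open>L\<close> into the set \<open>A\<close> of the points below \<open>y\<close>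
  and the set \<open>B\<close> of the points above \<open>y\<close>.

  The cut is not a gap. Both parts are closed in \<open>L\<close>, so both are clopen. If \<open>A\<close> were nonempty
  without a greatest element, a new point could be put between \<open>A\<close> and \<open>B\<close>, with the final segments
  of \<open>A\<close> as its punctured neighbourhoods; this would be a pospace in which \<open>L\<close> is not closed, against
  the H-closedness of \<open>L\<close>. This is \<open>H_closed_linear_initial_segment_has_greatest\<close>. So \<open>A\<close> is empty or
  has a greatest element \<open>a\<close>, and dually \<open>B\<close> is empty or has a least element \<open>b\<close>.

  Now let \<open>S\<close> be the set of the points of \<open>X\<close> outside \<open>L\<close> that cut \<open>L\<close> in the same way as \<open>y\<close>. If it
  is nonempty it is a maximal chain of the complement of \<open>L\<close> (\<open>maximal_chain_in_cut\<close>), hence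
  H-closed by hypothesis. Any other point of \<open>X\<close> outside \<open>L\<close> is below \<open>a\<close> or above \<open>b\<close>. Thus \<open>X\<close> is
  covered by \<open>L\<close>, \<open>S\<close>, the points below \<open>a\<close> and the points above \<open>b\<close>. These four sets are closed in
  \<open>Y\<close> and omit \<open>y\<close>, so \<open>y\<close> is not in the closure of \<open>X\<close>, a contradiction.
\<close>

section \<open>Linear orders and closed orders\<close>

lemma linear_order_on_comparable:
  assumes "linear_order_on A r" and "x \<in> A" and "y \<in> A"
  shows "(x, y) \<in> r \<or> (y, x) \<in> r"
  using assms by (cases "x = y") (auto simp: order_on_defs total_on_def refl_on_def)

lemma closedin_above:
  assumes "pospace X r" and "a \<in> topspace X"
  shows "closedin X (above r a)"
proof -
  have "continuous_map X (prod_topology X X) (\<lambda>x. (a, x))"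
    using assms(2) by (intro continuous_map_pairedI) auto
  then have "closedin X {x \<in> topspace X. (a, x) \<in> r}"
    using assms(1) by (intro closedin_continuous_map_preimage) (auto simp: pospace_def)
  moreover have "{x \<in> topspace X. (a, x) \<in> r} = above r a"
    using assms(1) by (auto simp: pospace_def order_on_defs above_def)
  ultimately show ?thesis
    by simp
qed

lemma under_converse: "under (r\<inverse>) a = above r a"
  by (simp add: above_def under_def)

lemma pospace_converse:
  assumes "pospace X r"
  shows "pospace X (r\<inverse>)"
proof -
  have "closedin (prod_topology X X) {p \<in> topspace (prod_topology X X). (\<lambda>(x, y). (y, x)) p \<in> r}"
    using assms homeomorphic_imp_continuous_map[OF homeomorphic_map_swap]
    by (intro closedin_continuous_map_preimage) (auto simp: pospace_def)
  moreover have "{p \<in> topspace (prod_topology X X). (\<lambda>(x, y). (y, x)) p \<in> r} = r\<inverse>"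
    using assms by (auto simp: pospace_def order_on_defs)
  ultimately show ?thesis
    using assms by (simp add: pospace_def)
qed

lemma closedin_under:
  assumes "pospace X r" and "a \<in> topspace X"
  shows "closedin X (under r a)"
  using closedin_above[OF pospace_converse[OF assms(1)] assms(2)]
  by (simp flip: under_converse)

lemma pospace_embedding_converse:
  "pospace_embedding X r Y s f \<Longrightarrow> pospace_embedding X (r\<inverse>) Y (s\<inverse>) f"
  by (auto simp: pospace_embedding_def)

lemma H_closed_pospace_converse:
  assumes "H_closed_pospace X r"
  shows "H_closed_pospace X (r\<inverse>)"
  unfolding H_closed_pospace_def
proof (intro conjI allI impI)
  show "pospace X (r\<inverse>)"
    using assms pospace_converse unfolding H_closed_pospace_def by blast
  fix Y :: "'a option topology" and s f
  assume "pospace Y s \<and> pospace_embedding X (r\<inverse>) Y s f"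
  then have "pospace Y (s\<inverse>)" "pospace_embedding X r Y (s\<inverse>) f"
    using pospace_converse pospace_embedding_converse[of X "r\<inverse>" Y s f] by auto
  then show "closedin Y (f ` topspace X)"
    using assms unfolding H_closed_pospace_def by blast
qed

lemma linear_pospace_subtopology:
  assumes "linear_pospace X r" and "L \<subseteq> topspace X"
  shows "linear_pospace (subtopology X L) (Restr r L)"
proof -
  have top: "topspace (subtopology X L) = L"
    using assms(2) by auto
  have "linear_order_on L (Restr r L)"
  proof -
    have po: "refl_on (topspace X) r" "trans r" "antisym r" "total_on (topspace X) r"
      using assms(1) by (auto simp: linear_pospace_def order_on_defs)
    have "refl_on L (Restr r L)"
      using po(1) assms(2) by (auto simp: refl_on_def)
    moreover have "trans (Restr r L)"
      using po(2) by (auto intro!: transI dest: transD)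
    moreover have "antisym (Restr r L)"
      using po(3) by (auto intro!: antisymI dest: antisymD)
    moreover have "total_on L (Restr r L)"
      using po(4) assms(2) by (auto simp: total_on_def)
    ultimately show ?thesis
      by (simp add: order_on_defs)
  qed
  moreover have "closedin (prod_topology (subtopology X L) (subtopology X L)) (Restr r L)"
    using assms(1) by (simp add: closedin_subtopology linear_pospace_def pospace_def
        flip: subtopology_Times) blast
  ultimately show ?thesis
    using assms(1) unfolding linear_pospace_def pospace_def top
    by (auto simp: linear_order_on_def intro: Hausdorff_space_subtopology)
qed

text \<open>
  For a linear order, closed principal rays suffice for the graph to be closed and for the space to be
  Hausdorff. If \<open>x < y\<close>, separate the two points at a point \<open>w\<close> strictly between them; if there is
  none, the open rays below \<open>y\<close> and above \<open>x\<close> are themselves disjoint. In both cases every point of the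
  one open ray is strictly below every point of the other, so the product of the rays separates
  \<open>(y, x)\<close> from the graph.
\<close>
lemma linear_pospaceI:
  assumes lin: "linear_order_on (topspace X) r"
    and up: "\<And>x. x \<in> topspace X \<Longrightarrow> closedin X (above r x)"
    and down: "\<And>x. x \<in> topspace X \<Longrightarrow> closedin X (under r x)"
  shows "linear_pospace X r"
proof -
  have rX: "r \<subseteq> topspace X \<times> topspace X" and tr: "trans r" and anti: "antisym r"
    and rf: "refl_on (topspace X) r"
    using lin by (auto simp: order_on_defs)
  have sep: "\<exists>U V. openin X U \<and> openin X V \<and> x \<in> U \<and> y \<in> V \<and> (\<forall>u\<in>U. \<forall>v\<in>V. (v, u) \<notin> r)"
    if xy: "x \<in> topspace X" "y \<in> topspace X" "(y, x) \<notin> r" for x y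
  proof (cases "\<exists>w\<in>topspace X. (x, w) \<in> r \<and> (w, y) \<in> r \<and> w \<noteq> x \<and> w \<noteq> y")
    case True
    then obtain w where w: "w \<in> topspace X" "(x, w) \<in> r" "(w, y) \<in> r" "w \<noteq> x" "w \<noteq> y"
      by blast
    show ?thesis
    proof (intro exI conjI)
      show "openin X (topspace X - above r w)" "openin X (topspace X - under r w)"
        using up down w(1) by blast+
      show "x \<in> topspace X - above r w" "y \<in> topspace X - under r w"
        using xy w anti by (auto simp: above_def under_def dest: antisymD)
      show "\<forall>u\<in>topspace X - above r w. \<forall>v\<in>topspace X - under r w. (v, u) \<notin> r"
      proof (intro ballI notI)
        fix u v assume uv: "u \<in> topspace X - above r w" "v \<in> topspace X - under r w" "(v, u) \<in> r"
        then have "(w, v) \<in> r"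
          using linear_order_on_comparable[OF lin w(1), of v] by (auto simp: under_def)
        then have "(w, u) \<in> r"
          using uv(3) by (rule transD[OF tr])
        then show False
          using uv(1) by (simp add: above_def)
      qed
    qed
  next
    case False
    show ?thesis
    proof (intro exI conjI)
      show "openin X (topspace X - above r y)" "openin X (topspace X - under r x)"
        using up down xy by blast+
      show "x \<in> topspace X - above r y" "y \<in> topspace X - under r x"
        using xy by (auto simp: above_def under_def)
      show "\<forall>u\<in>topspace X - above r y. \<forall>v\<in>topspace X - under r x. (v, u) \<notin> r"
      proof (intro ballI notI)
        fix u v assume uv: "u \<in> topspace X - above r y" "v \<in> topspace X - under r x" "(v, u) \<in> r"
        then have ne: "(u, y) \<in> r" "(x, v) \<in> r" "u \<noteq> y" "v \<noteq> x"
          using linear_order_on_comparable[OF lin] xy rf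
          by (auto simp: above_def under_def refl_on_def)
        then have "(v, y) \<in> r"
          using uv(3) by (blast intro: transD[OF tr])
        then have "v = y"
          using False uv(2) ne by blast
        then show False
          using uv by (simp add: above_def)
      qed
    qed
  qed
  have "Hausdorff_space X"
    unfolding Hausdorff_space_def
  proof (intro allI impI)
    fix x y assume xy: "x \<in> topspace X \<and> y \<in> topspace X \<and> x \<noteq> y"
    have disj: "disjnt U V" "disjnt V U" if "openin X U" "\<forall>u\<in>U. \<forall>v\<in>V. (v, u) \<notin> r" for U V
      using that rf openin_subset[OF that(1)] by (auto simp: disjnt_iff refl_on_def)
    from xy anti consider "(x, y) \<notin> r" | "(y, x) \<notin> r"
      by (auto dest: antisymD)
    then show "\<exists>U V. openin X U \<and> openin X V \<and> x \<in> U \<and> y \<in> V \<and> disjnt U V"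
      using sep[of x y] sep[of y x] xy disj by cases meson+
  qed
  moreover have "closedin (prod_topology X X) r"
  proof -
    have "openin (prod_topology X X) (topspace (prod_topology X X) - r)"
      unfolding openin_prod_topology_alt
    proof (intro allI impI)
      fix y x assume "(y, x) \<in> topspace (prod_topology X X) - r"
      then obtain U V where "openin X U" "openin X V" "x \<in> U" "y \<in> V" "\<forall>u\<in>U. \<forall>v\<in>V. (v, u) \<notin> r"
        using sep[of x y] by auto
      moreover from this have "V \<times> U \<subseteq> topspace (prod_topology X X) - r"
        using openin_subset[of X U] openin_subset[of X V] by auto
      ultimately show "\<exists>U V. openin X U \<and> openin X V \<and> y \<in> U \<and> x \<in> V \<and>
          U \<times> V \<subseteq> topspace (prod_topology X X) - r"
        by blast
    qed
    then show ?thesis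
      using rX by (simp add: closedin_def)
  qed
  ultimately show ?thesis
    using lin by (simp add: linear_pospace_def pospace_def linear_order_on_def)
qed

section \<open>Filling a gap with one point\<close>

text \<open>
  The new point \<open>None\<close> is the limit of \<open>A\<close> from below; it is not approached from above, which is
  consistent when the complement of \<open>A\<close> is open.
\<close>
definition gap_topology :: "'a topology \<Rightarrow> 'a rel \<Rightarrow> 'a set \<Rightarrow> 'a option topology" where
  "gap_topology X r A = topology (\<lambda>U. openin X (Some -` U) \<and>
     (None \<in> U \<longrightarrow> (\<exists>a\<in>A. above r a \<inter> A \<subseteq> Some -` U)))"

definition gap_order :: "'a topology \<Rightarrow> 'a rel \<Rightarrow> 'a set \<Rightarrow> 'a option rel" where
  "gap_order X r A = map_prod Some Some ` r \<union> {(None, None)} \<union> Some ` A \<times> {None} \<union>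
     {None} \<times> Some ` (topspace X - A)"

lemma gap_order_iff [simp]:
  "(Some x, Some y) \<in> gap_order X r A \<longleftrightarrow> (x, y) \<in> r"
  "(Some x, None) \<in> gap_order X r A \<longleftrightarrow> x \<in> A"
  "(None, Some x) \<in> gap_order X r A \<longleftrightarrow> x \<in> topspace X - A"
  "(None, None) \<in> gap_order X r A"
  by (auto simp: gap_order_def)

lemma openin_gap_topology:
  assumes "linear_order_on (topspace X) r" and "A \<subseteq> topspace X"
  shows "openin (gap_topology X r A) U \<longleftrightarrow> openin X (Some -` U) \<and>
     (None \<in> U \<longrightarrow> (\<exists>a\<in>A. above r a \<inter> A \<subseteq> Some -` U))"
proof -
  let ?P = "\<lambda>U. openin X (Some -` U) \<and> (None \<in> U \<longrightarrow> (\<exists>a\<in>A. above r a \<inter> A \<subseteq> Some -` U))"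
  have "istopology ?P"
    unfolding istopology_def
  proof (intro conjI allI impI)
    fix S T :: "'a option set"
    assume S: "?P S" and T: "?P T"
    show "openin X (Some -` (S \<inter> T))"
      using S T by auto
    assume "None \<in> S \<inter> T"
    then obtain a b where ab: "a \<in> A" "b \<in> A" "above r a \<inter> A \<subseteq> Some -` S" "above r b \<inter> A \<subseteq> Some -` T"
      using S T by auto
    have "(a, b) \<in> r \<or> (b, a) \<in> r"
      using linear_order_on_comparable[OF assms(1)] assms(2) ab(1,2) by blast
    moreover have "trans r"
      using assms(1) by (simp add: order_on_defs)
    ultimately have "above r a \<subseteq> above r b \<or> above r b \<subseteq> above r a"
      by (auto simp: above_def dest: transD)
    with ab show "\<exists>a\<in>A. above r a \<inter> A \<subseteq> Some -` (S \<inter> T)"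
      unfolding vimage_Int by blast
  next
    fix K :: "'a option set set"
    assume K: "\<forall>U\<in>K. ?P U"
    show "openin X (Some -` \<Union>K)"
      using K by (auto simp: vimage_Union)
    assume "None \<in> \<Union>K"
    then obtain U where U: "U \<in> K" "None \<in> U"
      by blast
    then obtain a where "a \<in> A" "above r a \<inter> A \<subseteq> Some -` U"
      using K by blast
    moreover have "Some -` U \<subseteq> Some -` \<Union>K"
      using U(1) by auto
    ultimately show "\<exists>a\<in>A. above r a \<inter> A \<subseteq> Some -` \<Union>K"
      by (meson order_trans)
  qed
  then show ?thesis
    unfolding gap_topology_def by (simp add: topology_inverse')
qed

lemma topspace_gap_topology:
  assumes "linear_order_on (topspace X) r" and "A \<subseteq> topspace X" and "A \<noteq> {}"
  shows "topspace (gap_topology X r A) = insert None (Some ` topspace X)"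
proof
  have "openin X (Some -` topspace (gap_topology X r A))"
    using openin_gap_topology[OF assms(1,2)] openin_topspace by blast
  then have "Some -` topspace (gap_topology X r A) \<subseteq> topspace X"
    by (rule openin_subset)
  then show "topspace (gap_topology X r A) \<subseteq> insert None (Some ` topspace X)"
    by (intro subsetI, rename_tac u, case_tac u) auto
  have "Some -` insert None (Some ` topspace X) = topspace X"
    by auto
  then have "openin (gap_topology X r A) (insert None (Some ` topspace X))"
    using assms by (auto simp: openin_gap_topology)
  then show "insert None (Some ` topspace X) \<subseteq> topspace (gap_topology X r A)"
    by (rule openin_subset)
qed

lemma linear_order_on_gap_order:
  assumes lin: "linear_order_on (topspace X) r" and A: "A \<subseteq> topspace X"
    and seg: "\<And>x z. x \<in> A \<Longrightarrow> (z, x) \<in> r \<Longrightarrow> z \<in> A"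
  shows "linear_order_on (insert None (Some ` topspace X)) (gap_order X r A)"
proof -
  have rX: "r \<subseteq> topspace X \<times> topspace X" and tr: "trans r" and anti: "antisym r"
    and tot: "total_on (topspace X) r" and rf: "refl_on (topspace X) r"
    using lin by (auto simp: order_on_defs)
  have "gap_order X r A \<subseteq> insert None (Some ` topspace X) \<times> insert None (Some ` topspace X)"
    using rX A by (auto simp: gap_order_def)
  moreover have "refl_on (insert None (Some ` topspace X)) (gap_order X r A)"
    using rf by (force simp: gap_order_def refl_on_def)
  moreover have "total_on (insert None (Some ` topspace X)) (gap_order X r A)"
    using tot by (force simp: gap_order_def total_on_def)
  moreover have "antisym (gap_order X r A)"
    using anti by (auto simp: gap_order_def antisym_def)
  moreover have "trans (gap_order X r A)"
  proof (rule transI)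
    fix u v w assume uvw: "(u, v) \<in> gap_order X r A" "(v, w) \<in> gap_order X r A"
    have cross: "(x, z) \<in> r" if "x \<in> A" "z \<in> topspace X" "z \<notin> A" for x z
      using linear_order_on_comparable[OF lin] that seg A by blast
    have up: "z \<in> topspace X \<and> z \<notin> A" if "(y, z) \<in> r" "y \<notin> A" for y z
      using that seg rX by blast
    show "(u, w) \<in> gap_order X r A"
    proof (cases u)
      case None
      then show ?thesis
        using uvw up by (cases v; cases w) auto
    next
      case (Some x)
      show ?thesis
      proof (cases v)
        case None
        then show ?thesis
          using uvw Some cross by (cases w) auto
      next
        case v: (Some y)
        then show ?thesis
          using uvw Some by (cases w) (auto intro: seg transD[OF tr])
      qed
    qed
  qed
  ultimately show ?thesis
    by (simp add: order_on_defs)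
qed

text \<open>
  Without a greatest element of \<open>A\<close>, each \<open>x\<close> in \<open>A\<close> has a final segment of \<open>A\<close> strictly above it, so
  that the ray below \<open>x\<close> stays closed when \<open>None\<close> is added. As \<open>A\<close> is clopen, the rays at \<open>None\<close> are
  closed too, and the enlarged space is a pospace. But \<open>None\<close> is not isolated in it, so \<open>X\<close> is not
  closed there.
\<close>
lemma H_closed_linear_initial_segment_has_greatest:
  assumes lin: "linear_pospace X r" and H: "H_closed_pospace X r"
    and op: "openin X A" and cl: "closedin X A"
    and seg: "\<And>x z. x \<in> A \<Longrightarrow> (z, x) \<in> r \<Longrightarrow> z \<in> A" and ne: "A \<noteq> {}"
  shows "\<exists>m\<in>A. \<forall>x\<in>A. (x, m) \<in> r"
proof (rule ccontr)
  assume nomax: "\<not> (\<exists>m\<in>A. \<forall>x\<in>A. (x, m) \<in> r)"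
  have X: "pospace X r" and lo: "linear_order_on (topspace X) r"
    using lin by (auto simp: linear_pospace_def)
  have A: "A \<subseteq> topspace X"
    using op by (rule openin_subset)
  have tr: "trans r" and rf: "refl_on (topspace X) r"
    using lo by (auto simp: order_on_defs)
  have bigger: "\<exists>a\<in>A. (a, x) \<notin> r" if "x \<in> A" for x
    using nomax that by blast
  let ?Z = "gap_topology X r A" and ?t = "gap_order X r A"
  note opZ = openin_gap_topology[OF lo A] and topZ = topspace_gap_topology[OF lo A ne]
  have loZ: "linear_order_on (topspace ?Z) ?t"
    unfolding topZ by (rule linear_order_on_gap_order[OF lo A seg])
  have closedI: "closedin ?Z C" if "C \<subseteq> topspace ?Z" "openin ?Z (topspace ?Z - C)" for C
    using that by (simp add: closedin_def)
  have opU: "openin X (topspace X - above r x)" "openin X (topspace X - under r x)"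
    if "x \<in> topspace X" for x
    using closedin_above[OF X that] closedin_under[OF X that] by blast+
  have tsub: "?t \<subseteq> topspace ?Z \<times> topspace ?Z"
    using loZ by (simp add: order_on_defs)
  have "linear_pospace ?Z ?t"
  proof (rule linear_pospaceI[OF loZ])
    fix u assume u: "u \<in> topspace ?Z"
    show "closedin ?Z (above ?t u)"
    proof (rule closedI)
      show "above ?t u \<subseteq> topspace ?Z"
        using tsub by (auto simp: above_def)
      show "openin ?Z (topspace ?Z - above ?t u)"
      proof (cases u)
        case None
        then have "Some -` (topspace ?Z - above ?t u) = A" "None \<notin> topspace ?Z - above ?t u"
          using A by (auto simp: topZ above_def)
        then show ?thesis
          using op by (auto simp: opZ)
      next
        case (Some x)
        then have x: "x \<in> topspace X"
          using u by (auto simp: topZ)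
        have pre: "Some -` (topspace ?Z - above ?t u) = topspace X - above r x"
          using Some by (auto simp: topZ above_def)
        have "\<exists>a\<in>A. above r a \<inter> A \<subseteq> topspace X - above r x" if "None \<in> topspace ?Z - above ?t u"
        proof -
          have "x \<notin> A"
            using that Some by (auto simp: above_def)
          then have "A \<subseteq> topspace X - above r x"
            using A seg by (auto simp: above_def)
          then show ?thesis
            using ne by blast
        qed
        then show ?thesis
          using opU[OF x] by (simp add: opZ pre)
      qed
    qed
    show "closedin ?Z (under ?t u)"
    proof (rule closedI)
      show "under ?t u \<subseteq> topspace ?Z"
        using tsub by (auto simp: under_def)
      show "openin ?Z (topspace ?Z - under ?t u)"
      proof (cases u)
        case None
        then have "Some -` (topspace ?Z - under ?t u) = topspace X - A"
            "None \<notin> topspace ?Z - under ?t u"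
          using A by (auto simp: topZ under_def)
        then show ?thesis
          using cl by (auto simp: opZ closedin_def)
      next
        case (Some x)
        then have x: "x \<in> topspace X"
          using u by (auto simp: topZ)
        have pre: "Some -` (topspace ?Z - under ?t u) = topspace X - under r x"
          using Some by (auto simp: topZ under_def)
        have "\<exists>a\<in>A. above r a \<inter> A \<subseteq> topspace X - under r x" if "None \<in> topspace ?Z - under ?t u"
        proof -
          have "x \<in> A"
            using that Some x by (auto simp: under_def)
          then obtain a where "a \<in> A" "(a, x) \<notin> r"
            using bigger by blast
          then show ?thesis
            using A by (intro bexI[of _ a]) (auto simp: above_def under_def dest: transD[OF tr])
        qed
        then show ?thesis
          using opU[OF x] by (simp add: opZ pre)
      qed
    qed
  qed
  then have Z: "pospace ?Z ?t"
    by (simp add: linear_pospace_def)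
  have "embedding_map X ?Z Some"
  proof (rule injective_open_imp_embedding_map)
    have "{x \<in> topspace X. Some x \<in> U} = Some -` U" if "openin ?Z U" for U
      using openin_subset[OF that] by (auto simp: topZ)
    then show "continuous_map X ?Z Some"
      by (auto simp: continuous_map_def topZ opZ)
    have "Some -` Some ` U = U" for U :: "'a set"
      by auto
    then show "open_map X ?Z Some"
      by (auto simp: open_map_def opZ)
  qed simp
  then have "pospace_embedding X r ?Z ?t Some"
    by (auto simp: pospace_embedding_def)
  then have "closedin ?Z (Some ` topspace X)"
    using H Z unfolding H_closed_pospace_def by blast
  then have "openin ?Z (topspace ?Z - Some ` topspace X)"
    by (simp add: openin_diff)
  moreover have "topspace ?Z - Some ` topspace X = {None}"
    by (auto simp: topZ)
  ultimately obtain a where "a \<in> A" "above r a \<inter> A \<subseteq> Some -` {None}"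
    by (auto simp: opZ)
  moreover have "a \<in> above r a"
    using \<open>a \<in> A\<close> A rf by (auto simp: above_def refl_on_def)
  ultimately show False
    by auto
qed

section \<open>Points of an extension\<close>

lemma pospace_embedding_subtopology:
  assumes "pospace_embedding X r Y s f" and "S \<subseteq> topspace X"
  shows "pospace_embedding (subtopology X S) (Restr r S) Y s f"
proof -
  have hom: "homeomorphic_map X (subtopology Y (f ` topspace X)) f"
    using assms(1) by (simp add: pospace_embedding_def embedding_map_def)
  have surj: "f ` topspace X = topspace (subtopology Y (f ` topspace X))"
    by (rule homeomorphic_imp_surjective_map[OF hom])
  have "f ` (topspace X \<inter> S) = topspace (subtopology Y (f ` topspace X)) \<inter> f ` S"
    unfolding surj[symmetric] using assms(2) by blast
  from homeomorphic_map_subtopologies[OF hom this]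
  have "homeomorphic_map (subtopology X S) (subtopology Y (f ` S)) f"
    using assms(2) by (simp add: subtopology_subtopology Int_absorb1 image_mono)
  then show ?thesis
    using assms unfolding pospace_embedding_def embedding_map_def
    by (auto simp: Int_absorb1)
qed

text \<open>The points comparable to \<open>u\<close> form a closed set, the union of the two rays at \<open>u\<close>.\<close>
lemma comparable_with_closure_of_chain:
  assumes Y: "pospace Y s" and C: "C \<subseteq> topspace Y"
    and chain: "\<And>u v. u \<in> C \<Longrightarrow> v \<in> C \<Longrightarrow> (u, v) \<in> s \<or> (v, u) \<in> s"
    and y: "y \<in> Y closure_of C" and u: "u \<in> C"
  shows "(u, y) \<in> s \<or> (y, u) \<in> s"
proof -
  have "closedin Y (above s u \<union> under s u)"
    using closedin_above[OF Y] closedin_under[OF Y] u C by blast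
  moreover have "C \<subseteq> above s u \<union> under s u"
    using chain u by (auto simp: above_def under_def)
  ultimately have "y \<in> above s u \<union> under s u"
    using y closure_of_minimal by blast
  then show ?thesis
    by (auto simp: above_def under_def)
qed

text \<open>
  The set \<open>C\<close> is the ray below the greatest point of \<open>X\<close> under \<open>y\<close>, or empty if there is no point
  under \<open>y\<close>. Stating only that \<open>C\<close> exists treats both cases at once, and the version for the points
  above \<open>y\<close> follows by passing to the converse orders.
\<close>
lemma H_closed_linear_closed_lower_cover:
  assumes lin: "linear_pospace X r" and H: "H_closed_pospace X r"
    and Y: "pospace Y s" and f: "pospace_embedding X r Y s f"
    and y: "y \<in> topspace Y" "y \<notin> f ` topspace X"
    and comp: "\<And>x. x \<in> topspace X \<Longrightarrow> (f x, y) \<in> s \<or> (y, f x) \<in> s"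
  shows "\<exists>C. closedin Y C \<and> y \<notin> C \<and> (\<forall>x\<in>topspace X. (f x, y) \<in> s \<longrightarrow> under s (f x) \<subseteq> C)"
proof (cases "\<exists>x\<in>topspace X. (f x, y) \<in> s")
  case False
  then show ?thesis
    by (intro exI[of _ "{}"]) auto
next
  case True
  define A where "A = {x \<in> topspace X. (f x, y) \<in> s}"
  have "homeomorphic_map X (subtopology Y (f ` topspace X)) f"
    using f by (simp add: pospace_embedding_def embedding_map_def)
  then have cont: "continuous_map X Y f"
    using homeomorphic_imp_continuous_map continuous_map_in_subtopology by blast
  have tr: "trans s" and anti: "antisym s"
    using Y by (auto simp: pospace_def order_on_defs)
  have rX: "r \<subseteq> topspace X \<times> topspace X"
    using lin by (auto simp: linear_pospace_def order_on_defs)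
  have fr: "(x, z) \<in> r \<longleftrightarrow> (f x, f z) \<in> s" if "x \<in> topspace X" "z \<in> topspace X" for x z
    using f that by (simp add: pospace_embedding_def)
  have "closedin X {x \<in> topspace X. f x \<in> under s y}"
    by (rule closedin_continuous_map_preimage[OF cont closedin_under[OF Y y(1)]])
  then have cl: "closedin X A"
    by (simp add: A_def under_def)
  have "closedin X {x \<in> topspace X. f x \<in> above s y}"
    by (rule closedin_continuous_map_preimage[OF cont closedin_above[OF Y y(1)]])
  moreover have "{x \<in> topspace X. f x \<in> above s y} = topspace X - A"
    using comp y(2) anti by (auto simp: A_def above_def dest: antisymD)
  ultimately have op: "openin X A"
    by (auto simp: openin_closedin_eq A_def)
  have "\<exists>m\<in>A. \<forall>x\<in>A. (x, m) \<in> r"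
  proof (rule H_closed_linear_initial_segment_has_greatest[OF lin H op cl])
    fix x z assume "x \<in> A" "(z, x) \<in> r"
    then show "z \<in> A"
      using rX fr[of z x] tr by (auto simp: A_def dest: transD)
  next
    show "A \<noteq> {}"
      using True by (auto simp: A_def)
  qed
  then obtain m where m: "m \<in> A" "\<And>x. x \<in> A \<Longrightarrow> (x, m) \<in> r"
    by blast
  have mX: "m \<in> topspace X" and my: "(f m, y) \<in> s"
    using m(1) by (auto simp: A_def)
  show ?thesis
  proof (intro exI[of _ "under s (f m)"] conjI ballI impI)
    show "closedin Y (under s (f m))"
      using closedin_under[OF Y] cont mX by (simp add: continuous_map_def Pi_iff)
    show "y \<notin> under s (f m)"
      using my y(2) mX anti by (auto simp: under_def dest: antisymD)
    fix x assume "x \<in> topspace X" "(f x, y) \<in> s"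
    then have "(f x, f m) \<in> s"
      using m(2)[of x] fr[OF _ mX] by (simp add: A_def)
    then show "under s (f x) \<subseteq> under s (f m)"
      using tr by (auto simp: under_def dest: transD)
  qed
qed

text \<open>
  Two points outside \<open>L\<close> belong to a common chain of the complement of \<open>L\<close> exactly when no point of \<open>L\<close> lies
  between them, that is, when they cut \<open>L\<close> in the same way. So the points whose trace on
  \<open>L\<close> is given by \<open>D\<close> form a maximal chain as soon as there is one.
\<close>
lemma maximal_chain_in_cut:
  assumes lin: "linear_order_on (topspace X) r" and L: "L \<subseteq> topspace X"
    and S: "S = {x \<in> topspace X - L. \<forall>l\<in>L. (l, x) \<in> r \<longleftrightarrow> l \<in> D}" and ne: "S \<noteq> {}"
  shows "maximal_chain_in r (topspace X - L) S"
proof -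
  have rX: "r \<subseteq> topspace X \<times> topspace X" and tr: "trans r" and anti: "antisym r"
    using lin by (auto simp: order_on_defs)
  have "chain_in r (topspace X - L) S"
    unfolding chain_in_def
  proof (intro conjI ballI impI subsetI)
    fix x z w assume *: "x \<in> S" "z \<in> S" "(x, z) \<in> r" "w \<in> above r x \<inter> under r z"
    then have w: "(x, w) \<in> r" "(w, z) \<in> r"
      by (auto simp: above_def under_def)
    have "w \<notin> L"
    proof
      assume "w \<in> L"
      then have "(w, x) \<in> r"
        using * w by (auto simp: S)
      then have "w = x"
        using w anti by (auto dest: antisymD)
      then show False
        using * \<open>w \<in> L\<close> by (auto simp: S)
    qed
    then show "w \<in> topspace X - L"
      using w rX by auto
  qed (auto simp: S)
  moreover have "T \<subseteq> S" if T: "chain_in r (topspace X - L) T" and ST: "S \<subset> T" for T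
  proof
    fix t assume t: "t \<in> T"
    obtain x where x: "x \<in> S" "x \<in> T"
      using ne ST by blast
    have tX: "t \<in> topspace X - L"
      using T t by (auto simp: chain_in_def)
    have "(l, t) \<in> r \<longleftrightarrow> (l, x) \<in> r" if l: "l \<in> L" for l
    proof -
      have "\<not> ((x, l) \<in> r \<and> (l, t) \<in> r)" "\<not> ((t, l) \<in> r \<and> (l, x) \<in> r)"
        using T t x(2) l tr unfolding chain_in_def above_def under_def trans_def by blast+
      moreover have "l \<noteq> x" "l \<noteq> t"
        using l x(1) tX by (auto simp: S)
      ultimately show ?thesis
        using linear_order_on_comparable[OF lin] l L tX x(1) unfolding S by blast
    qed
    then show "t \<in> S"
      using tX x(1) by (auto simp: S)
  qed
  ultimately show ?thesis
    unfolding maximal_chain_in_def by blast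
qed

section \<open>Gluing H-closed chains\<close>

theorem theorem4p4:
  fixes X :: "'a topology" and r :: "'a rel" and L :: "'a set"
  assumes "linear_pospace X r"
    and "L \<subseteq> topspace X"
    and "H_closed_pospace (subtopology X L) (Restr r L)"
    and "\<And>S. maximal_chain_in r (topspace X - L) S \<Longrightarrow>
           H_closed_pospace (subtopology X S) (Restr r S)"
  shows "H_closed_pospace X r"
  unfolding H_closed_pospace_def
proof (intro conjI allI impI)
  show "pospace X r"
    using assms(1) by (simp add: linear_pospace_def)
  fix Y :: "'a option topology" and s f
  assume "pospace Y s \<and> pospace_embedding X r Y s f"
  then have Y: "pospace Y s" and f: "pospace_embedding X r Y s f"
    by auto
  have lo: "linear_order_on (topspace X) r"
    using assms(1) by (simp add: linear_pospace_def)
  have fr: "(x, z) \<in> r \<longleftrightarrow> (f x, f z) \<in> s" if "x \<in> topspace X" "z \<in> topspace X" for x z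
    using f that by (simp add: pospace_embedding_def)
  have hom: "homeomorphic_map X (subtopology Y (f ` topspace X)) f"
    using f by (simp add: pospace_embedding_def embedding_map_def)
  have "f ` topspace X = topspace (subtopology Y (f ` topspace X))"
    by (rule homeomorphic_imp_surjective_map[OF hom])
  then have sub: "f ` topspace X \<subseteq> topspace Y"
    by (metis Int_lower1 topspace_subtopology)
  have closed_image: "closedin Y (f ` S)"
    if "S \<subseteq> topspace X" "H_closed_pospace (subtopology X S) (Restr r S)" for S
    using H_closed_pospace_closedin[OF that(2) Y pospace_embedding_subtopology[OF f that(1)]] that(1)
    by (simp add: Int_absorb1)
  \<comment> \<open>Suppose a point \<open>y\<close> of the closure is missing. It is enough to cover the image of \<open>X\<close> by
    finitely many closed sets that avoid \<open>y\<close>.\<close>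
  have "Y closure_of (f ` topspace X) \<subseteq> f ` topspace X"
  proof (rule subsetI, rule ccontr)
    fix y assume y: "y \<in> Y closure_of (f ` topspace X)" "y \<notin> f ` topspace X"
    have yY: "y \<in> topspace Y"
      using y(1) by (simp add: in_closure_of)
    have comp: "(f x, y) \<in> s \<or> (y, f x) \<in> s" if "x \<in> topspace X" for x
    proof (rule comparable_with_closure_of_chain[OF Y sub _ y(1)])
      show "(u, v) \<in> s \<or> (v, u) \<in> s" if "u \<in> f ` topspace X" "v \<in> f ` topspace X" for u v
        using that fr linear_order_on_comparable[OF lo] by blast
    qed (use that in simp)
    have topL: "topspace (subtopology X L) = L"
      using assms(2) by auto
    have compL: "(f l, y) \<in> s \<or> (y, f l) \<in> s" "(y, f l) \<in> s \<or> (f l, y) \<in> s" if "l \<in> L" for l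
      using comp[of l] that assms(2) by auto
    note linL = linear_pospace_subtopology[OF assms(1,2)]
      and fL = pospace_embedding_subtopology[OF f assms(2)]
    have yL: "y \<notin> f ` topspace (subtopology X L)"
      using y(2) by auto
    obtain C where C: "closedin Y C" "y \<notin> C" "\<And>l. l \<in> L \<Longrightarrow> (f l, y) \<in> s \<Longrightarrow> under s (f l) \<subseteq> C"
      using H_closed_linear_closed_lower_cover[OF linL assms(3) Y fL yY yL] compL(1)
      unfolding topL by blast
    have linL': "linear_pospace (subtopology X L) ((Restr r L)\<inverse>)"
      using linL pospace_converse by (auto simp: linear_pospace_def)
    obtain D where D: "closedin Y D" "y \<notin> D" "\<And>l. l \<in> L \<Longrightarrow> (y, f l) \<in> s \<Longrightarrow> above s (f l) \<subseteq> D"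
      using H_closed_linear_closed_lower_cover[OF linL' H_closed_pospace_converse[OF assms(3)]
          pospace_converse[OF Y] pospace_embedding_converse[OF fL] yY yL] compL(2)
      unfolding topL under_converse converse_iff by blast
    \<comment> \<open>The points outside \<open>L\<close> that cut \<open>L\<close> exactly as \<open>y\<close> does.\<close>
    define S where "S = {x \<in> topspace X - L. \<forall>l\<in>L. (l, x) \<in> r \<longleftrightarrow> l \<in> {l. (f l, y) \<in> s}}"
    have clS: "closedin Y (f ` S)"
    proof (cases "S = {}")
      case False
      have "maximal_chain_in r (topspace X - L) S"
        by (rule maximal_chain_in_cut[OF lo assms(2) S_def False])
      then show ?thesis
        by (intro closed_image assms(4)) (auto simp: S_def)
    qed simp
    have clL: "closedin Y (f ` L)"
      using closed_image assms(2,3) by blast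
    have "f ` topspace X \<subseteq> f ` L \<union> f ` S \<union> C \<union> D"
    proof
      fix v assume "v \<in> f ` topspace X"
      then obtain x where x: "x \<in> topspace X" "v = f x"
        by blast
      show "v \<in> f ` L \<union> f ` S \<union> C \<union> D"
      proof (cases "x \<in> L \<or> x \<in> S")
        case False
        \<comment> \<open>Some \<open>l\<close> in \<open>L\<close> separates \<open>f x\<close> from \<open>y\<close>, so \<open>f x\<close> lies in \<open>C\<close> or in \<open>D\<close>.\<close>
        then obtain l where l: "l \<in> L" "((l, x) \<in> r) \<noteq> ((f l, y) \<in> s)"
          using x by (auto simp: S_def)
        have lX: "l \<in> topspace X"
          using l assms(2) by auto
        show ?thesis
        proof (cases "(f l, y) \<in> s")
          case True
          then have "(x, l) \<in> r"
            using linear_order_on_comparable[OF lo lX x(1)] l(2) by blast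
          then show ?thesis
            using C(3)[OF l(1) True] fr x lX by (auto simp: under_def)
        next
          case nle: False
          then have "(f l, f x) \<in> s" "(y, f l) \<in> s"
            using l comp fr x lX by auto
          then show ?thesis
            using D(3)[OF l(1)] x by (auto simp: above_def)
        qed
      qed (use x in auto)
    qed
    moreover have "closedin Y (f ` L \<union> f ` S \<union> C \<union> D)"
      using clL clS C(1) D(1) by blast
    ultimately have "y \<in> f ` L \<union> f ` S \<union> C \<union> D"
      using y(1) closure_of_minimal by blast
    then show False
      using y(2) C(2) D(2) assms(2) by (auto simp: S_def)
  qed
  then show "closedin Y (f ` topspace X)"
    using closure_of_subset_eq sub by blast
qed

end
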